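(* Let $\mathcal M$ be a non-empty set and let $\mathcal F$ be a linear subspace of the space $\{\varphi\colon\mathcal M\to\mathbb R\}$ of all real-valued functions on $\mathcal M$. Then for every function $f\colon\mathcal M\to\mathbb R\cup\{+\infty,-\infty\}$, the $\mathcal F$-biconjugate of $f$ coincides with the $\mathcal F$-regularization of $f$: $$f^{\star\star}_{\mathcal F}=\operatorname{reg}_{\mathcal F}(f).$$
   Context: Write $\mathbb R_{\pm\infty}=\mathbb R\cup\{+\infty,-\infty\}$ with the usual order and arithmetic; $a-b:=a+(-1)b$, and $(+\infty)+(-\infty)$ is undefined. Suprema over the empty set are $-\infty$; suprema of sets of functions and inequalities between functions are pointwise. For a non-empty set $S$ and $h,\varphi\colon S\to\mathbb R_{\pm\infty}$, let $\operatorname{dom}(\varphi-h)$ be the set of $x\in S$ at which $\varphi(x)-h(x)$ is defined. The nonlinear Fenchel conjugate of $h$ is the map $h^\star$ from the set of all functions $S\to\mathbb R_{\pm\infty}$ to $\mathbb R_{\pm\infty}$, $h^\star(\varphi)=\sup\{\varphi(x)-h(x): x\in\operatorname{dom}(\varphi-h)\}$. $\mathcal F$-biconjugate: for $x\in\mathcal M$ let $\delta_x\colon\mathcal F\to\mathbb R$, $\delta_x(\varphi)=\varphi(x)$. Let $f^\star|_{\mathcal F}\colon\mathcal F\to\mathbb R_{\pm\infty}$ be the restriction of $f^\star$ to $\mathcal F$, and form its nonlinear Fenchel conjugate $(f^\star|_{\mathcal F})^\star$ (with $S=\mathcal F$). Then $f^{\star\star}_{\mathcal F}\colon\mathcal M\to\mathbb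 R_{\pm\infty}$ is $f^{\star\star}_{\mathcal F}(x):=(f^\star|_{\mathcal F})^\star(\delta_x)$. $\mathcal F$-regularization: with $\widetilde{\mathcal F}:=\{\varphi+c:\varphi\in\mathcal F,\ c\in\mathbb R\}$, $\operatorname{reg}_{\mathcal F}(f)(x):=\sup\{\varphi(x):\varphi\in\widetilde{\mathcal F},\ \varphi\le f\}$ for $x\in\mathcal M$. *)

theory Defs
  imports Complex_Main "HOL-Library.Extended_Real" "HOL-Library.Function_Algebras"
begin

(* The real vector space of all functions 'a => real; addition and zero are the pointwise
   ones of Function_Algebras, and the scalar multiplication is pointwise as well. *)
global_interpretation real_fun: vector_space "\<lambda>(c::real) (\<phi>::'a \<Rightarrow> real) x. c * \<phi> x"
  by unfold_locales (auto simp: fun_eq_iff algebra_simps)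

(* In ereal, \<infinity> + (-\<infinity>) is the total value \<infinity>; this predicate singles out the sums
   that are defined in the usual arithmetic of the extended reals. *)
definition add_defined :: "ereal \<Rightarrow> ereal \<Rightarrow> bool" where
  "add_defined a b \<longleftrightarrow> \<not> (a = \<infinity> \<and> b = -\<infinity>) \<and> \<not> (a = -\<infinity> \<and> b = \<infinity>)"

(* A function on a set S is given by a total function of which only the values on S matter. *)
definition dom_diff :: "'s set \<Rightarrow> ('s \<Rightarrow> ereal) \<Rightarrow> ('s \<Rightarrow> ereal) \<Rightarrow> 's set" where
  "dom_diff S \<phi> h = {x \<in> S. add_defined (\<phi> x) (- h x)}"

definition fenchel_conjugate :: "'s set \<Rightarrow> ('s \<Rightarrow> ereal) \<Rightarrow> ('s \<Rightarrow> ereal) \<Rightarrow> ereal" where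
  "fenchel_conjugate S h \<phi> = (SUP x \<in> dom_diff S \<phi> h. \<phi> x - h x)"

(* The inner conjugate, with elements of F read as extended-real-valued functions, is the
   restriction of the conjugate of f to F; the outer conjugate is taken over the set F and
   evaluated at the point evaluation at x. The ground set is the whole type 'a. *)
definition biconjugate :: "('a \<Rightarrow> real) set \<Rightarrow> ('a \<Rightarrow> ereal) \<Rightarrow> 'a \<Rightarrow> ereal" where
  "biconjugate F f x =
     fenchel_conjugate F (\<lambda>\<phi>. fenchel_conjugate UNIV f (\<lambda>y. ereal (\<phi> y))) (\<lambda>\<phi>. ereal (\<phi> x))"

definition const_shifts :: "('a \<Rightarrow> real) set \<Rightarrow> ('a \<Rightarrow> real) set" where
  "const_shifts F = {\<lambda>x. \<phi> x + c |\<phi> c. \<phi> \<in> F}"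

definition regularization :: "('a \<Rightarrow> real) set \<Rightarrow> ('a \<Rightarrow> ereal) \<Rightarrow> 'a \<Rightarrow> ereal" where
  "regularization F f x = (SUP \<phi> \<in> {\<phi> \<in> const_shifts F. \<forall>y. ereal (\<phi> y) \<le> f y}. ereal (\<phi> x))"

end

theory Submission
  imports Defs
begin

text \<open>For real \<open>\<phi>\<close> and \<open>c\<close>, the bound \<open>f\<^sup>\<star> \<phi> \<le> c\<close> says exactly that the shift \<open>\<phi> - c\<close> minorizes
  \<open>f\<close>. Comparing both sides with an arbitrary real number \<open>z\<close> below them treats finite and infinite
  values of \<open>f\<^sup>\<star> \<phi>\<close> alike: \<open>z \<le> \<phi> x - f\<^sup>\<star> \<phi>\<close> means that the shift of \<open>\<phi>\<close> with value \<open>z\<close> at \<open>x\<close>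
  minorizes \<open>f\<close>.\<close>

text \<open>A sum with a real summand is always defined, so \<open>dom_diff\<close> is all of
  \<open>S\<close>. This covers both conjugates in \<open>biconjugate\<close>, as point evaluations
  are real-valued too.\<close>

lemma fenchel_conjugate_real:
  "fenchel_conjugate S h (\<lambda>x. ereal (\<phi> x)) = (SUP x \<in> S. ereal (\<phi> x) - h x)"
  by (simp add: fenchel_conjugate_def dom_diff_def add_defined_def)

lemma fenchel_conjugate_le_real_iff:
  "fenchel_conjugate UNIV f (\<lambda>x. ereal (\<phi> x)) \<le> ereal c \<longleftrightarrow> (\<forall>y. ereal (\<phi> y - c) \<le> f y)"
proof -
  have "ereal (\<phi> y) - f y \<le> ereal c \<longleftrightarrow> ereal (\<phi> y - c) \<le> f y" for y
    by (cases "f y") auto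
  then show ?thesis
    by (simp add: fenchel_conjugate_real SUP_le_iff)
qed

text \<open>Negation reduces this to \<open>ereal_le_real\<close>, which tests with real upper
  bounds.\<close>

lemma ereal_le_if_real_below:
  fixes a b :: ereal
  assumes "\<And>z::real. ereal z \<le> a \<Longrightarrow> ereal z \<le> b"
  shows "a \<le> b"
proof -
  have "- b \<le> - a"
  proof (rule ereal_le_real)
    fix z assume "- a \<le> ereal z"
    then have "ereal (- z) \<le> a" by (cases a) auto
    then have "ereal (- z) \<le> b" by (rule assms)
    then show "- b \<le> ereal z" by (cases b) auto
  qed
  then show ?thesis by simp
qed

lemma biconjugate_eq_regularization: "biconjugate F f x = regularization F f x"
proof (rule antisym)
  let ?conj = "\<lambda>\<phi>::'a \<Rightarrow> real. fenchel_conjugate UNIV f (\<lambda>y. ereal (\<phi> y))"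
  have bi: "biconjugate F f x = (SUP \<phi> \<in> F. ereal (\<phi> x) - ?conj \<phi>)"
    by (simp add: biconjugate_def fenchel_conjugate_real)
  show "biconjugate F f x \<le> regularization F f x"
    unfolding bi
  proof (rule SUP_least, rule ereal_le_if_real_below)
    fix \<phi> z assume "\<phi> \<in> F" and z: "ereal z \<le> ereal (\<phi> x) - ?conj \<phi>"
    let ?\<psi> = "\<lambda>y. \<phi> y + (z - \<phi> x)"
    \<comment> \<open>The real \<open>z\<close> rules out the value \<infinity> of the conjugate; at
      -\<infinity> the claim is trivial.\<close>
    have "?conj \<phi> \<le> ereal (\<phi> x - z)"
      using z by (cases "?conj \<phi>") auto
    then have "\<forall>y. ereal (?\<psi> y) \<le> f y"
      by (simp add: fenchel_conjugate_le_real_iff algebra_simps)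
    moreover have "?\<psi> \<in> const_shifts F"
      using \<open>\<phi> \<in> F\<close> by (auto simp: const_shifts_def)
    ultimately have "ereal (?\<psi> x) \<le> regularization F f x"
      unfolding regularization_def by (intro SUP_upper) simp
    then show "ereal z \<le> regularization F f x" by simp
  qed
  show "regularization F f x \<le> biconjugate F f x"
    unfolding regularization_def
  proof (rule SUP_least, clarsimp simp: const_shifts_def)
    fix \<phi> c assume "\<phi> \<in> F" and "\<forall>y. ereal (\<phi> y + c) \<le> f y"
    then have "?conj \<phi> \<le> ereal (- c)"
      by (simp add: fenchel_conjugate_le_real_iff)
    \<comment> \<open>The bound \<open>- c\<close> rules out \<infinity>; at -\<infinity> the
      right-hand side is \<infinity>.\<close>
    then have "ereal (\<phi> x + c) \<le> ereal (\<phi> x) - ?conj \<phi>"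
      by (cases "?conj \<phi>") auto
    also have "\<dots> \<le> biconjugate F f x"
      unfolding bi using \<open>\<phi> \<in> F\<close> by (rule SUP_upper)
    finally show "ereal (\<phi> x + c) \<le> biconjugate F f x" .
  qed
qed

theorem theorem4p14:
  fixes F :: "('a \<Rightarrow> real) set" and f :: "'a \<Rightarrow> ereal"
  assumes "real_fun.subspace F"
  shows "biconjugate F f = regularization F f"
  by (rule ext) (rule biconjugate_eq_regularization)

end
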